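(* Let $\lambda\in\mathbb R$ with $\lambda>0$. Then the limiting probability, as $n\to\infty$, that in a uniformly random assignment of $\lfloor\lambda n\rfloor$ drivers to $n$ spaces all spaces are occupied is $$\lim_{n\to\infty}\frac{\mathrm{cp}\big(n,\lfloor\lambda n\rfloor,\lfloor\lambda n\rfloor-n\big)}{n^{\lfloor\lambda n\rfloor}}=\begin{cases}0 & \text{if }\lambda\le 1,\\ 1-\frac1\lambda\, T\big(\lambda e^{-\lambda}\big) & \text{if }\lambda>1.\end{cases}$$
   Context: Car parking problem: a car park has $n$ spaces in a line, numbered $1,\dots,n$, and $m$ drivers arrive one after the other. Each driver has chosen a preferred space, so an assignment is a function $f:\{1,\dots,m\}\to\{1,\dots,n\}$, and there are $n^m$ assignments; a random assignment is one chosen uniformly among these. Each arriving driver parks in the chosen space if it is free; otherwise the driver takes the first free space with a larger number, if there is one; if there is none, the driver fails to park and goes home. $\mathrm{cp}(n,m,k)$ denotes the number of assignments for which exactly $k$ drivers fail to park; it is $0$ if $k<0$. All spaces end up occupied if and only if exactly $m-n$ drivers fail to park. $T$ denotes the tree function $$T(v)=\sum_{i=1}^\infty \frac{i^{i-1}}{i!}\,v^i .$$ *)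

theory Defs
  imports "HOL-Probability.Probability"
begin

text \<open>The space taken by a driver with preferred space \<open>p\<close> in a car park with spaces
  \<open>{1..n}\<close> whose spaces in \<open>S\<close> are taken; \<open>None\<close> means that the driver fails to park.\<close>

definition parking_space :: "nat \<Rightarrow> nat set \<Rightarrow> nat \<Rightarrow> nat option" where
  "parking_space n S p =
     (if p \<notin> S then Some p
      else if {p<..n} - S \<noteq> {} then Some (Min ({p<..n} - S))
      else None)"

text \<open>The spaces taken after drivers \<open>1, ..., j\<close> have arrived, in this order.\<close>

primrec occupied :: "nat \<Rightarrow> (nat \<Rightarrow> nat) \<Rightarrow> nat \<Rightarrow> nat set" where
  "occupied n f 0 = {}"
| "occupied n f (Suc j) =
     occupied n f j \<union> set_option (parking_space n (occupied n f j) (f (Suc j)))"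

definition failing :: "nat \<Rightarrow> nat \<Rightarrow> (nat \<Rightarrow> nat) \<Rightarrow> nat set" where
  "failing n m f = {i \<in> {1..m}. parking_space n (occupied n f (i - 1)) (f i) = None}"

definition assignments :: "nat \<Rightarrow> nat \<Rightarrow> (nat \<Rightarrow> nat) set" where
  "assignments n m = {1..m} \<rightarrow>\<^sub>E {1..n}"

text \<open>The number of failing drivers is an integer argument, so that \<open>cp n m (m - n)\<close> is \<open>0\<close>
  for \<open>m < n\<close>.\<close>

definition cp :: "nat \<Rightarrow> nat \<Rightarrow> int \<Rightarrow> nat" where
  "cp n m k = card {f \<in> assignments n m. int (card (failing n m f)) = k}"

definition prob_full :: "nat \<Rightarrow> nat \<Rightarrow> real" where
  "prob_full n m =
     measure_pmf.prob (pmf_of_set (assignments n m)) {f. occupied n f m = {1..n}}"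

text \<open>The series starts at exponent \<open>1\<close>; the summation index is shifted by one. It converges
  for \<open>\<bar>v\<bar> \<le> exp (-1)\<close>, and \<open>x * exp (-x)\<close> lies in this range for \<open>x \<ge> 0\<close>.\<close>

definition tree_function :: "real \<Rightarrow> real" where
  "tree_function v = (\<Sum>i. real (Suc i) ^ i / fact (Suc i) * v ^ Suc i)"

end

theory Submission
  imports Defs
begin

text \<open>Summing over the first space that stays empty turns the problem into a series to which dominated
  convergence applies.

  A car park is full if and only if, for every \<open>j\<close>, at least \<open>j\<close> drivers want one of the first \<open>j\<close> spaces:
  a space stays free exactly when no car wants it or passes it
  (\<open>occupied_full_iff_covering\<close>). In every other assignment, let \<open>j + 1\<close> be the first space that stays
  empty. Then exactly \<open>j\<close> drivers want spaces to the left of it, they form a parking function on these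
  \<open>j\<close> spaces, and the remaining \<open>m - j\<close> drivers choose freely among the \<open>n - j - 1\<close> spaces to the right. As
  there are \<open>(j + 1) ^ (j - 1)\<close> parking functions of size \<open>j\<close> (\<open>card_covering_card\<close>), the probability that
  the car park is full is, for \<open>n > 0\<close> (\<open>power_eq_card_covering_plus_gaps\<close>, \<open>prob_full_eq_sum\<close>),
  \<open>1 - (\<Sum>j<n. (m choose j) * (j + 1) ^ (j - 1) * (n - j - 1) ^ (m - j) / n ^ m)\<close>.

  Let \<open>m = \<lfloor>\<lambda> n\<rfloor>\<close> with \<open>\<lambda> > 1\<close>. For fixed \<open>j\<close>, the summand tends to
  \<open>\<lambda> ^ j / j! * (j + 1) ^ (j - 1) * exp (- (j + 1) * \<lambda>)\<close>, which is \<open>1 / \<lambda>\<close> times the term of index \<open>j + 1\<close> of the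
  tree function at \<open>\<lambda> * exp (- \<lambda>)\<close> (\<open>gap_prob_tendsto\<close>). The summands are dominated by the terms of a
  convergent geometric series with ratio \<open>\<lambda> * exp (1 - \<lambda>)\<close> (\<open>gap_prob_le\<close>), so the sums
  converge to the sum of the limits by Tannery's theorem.

  For \<open>\<lambda> < 1\<close> there are fewer drivers than spaces. For \<open>\<lambda> = 1\<close> the probability is
  \<open>(n + 1) ^ (n - 1) / n ^ n\<close>, which tends to \<open>0\<close>.\<close>

section \<open>Alternating binomial sums and Abel's identity\<close>

lemma sum_binomial_Suc:
  fixes h :: "nat \<Rightarrow> real"
  shows "(\<Sum>j\<le>Suc m. real (Suc m choose j) * h j) = (\<Sum>j\<le>m. real (m choose j) * (h j + h (Suc j)))"
proof -
  have "(\<Sum>j\<le>Suc m. real (Suc m choose j) * h j)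
      = h 0 + (\<Sum>j\<le>m. real (Suc m choose Suc j) * h (Suc j))"
    by (subst sum.atMost_Suc_shift) simp
  also have "\<dots> = (h 0 + (\<Sum>j\<le>m. real (m choose Suc j) * h (Suc j))) + (\<Sum>j\<le>m. real (m choose j) * h (Suc j))"
    by (simp add: distrib_right sum.distrib)
  also have "h 0 + (\<Sum>j\<le>m. real (m choose Suc j) * h (Suc j)) = (\<Sum>j\<le>Suc m. real (m choose j) * h j)"
    by (subst sum.atMost_Suc_shift) simp
  also have "\<dots> = (\<Sum>j\<le>m. real (m choose j) * h j)"
    by simp
  finally show ?thesis
    by (simp add: distrib_left sum.distrib)
qed

text \<open>This is the vanishing of the \<open>m\<close>-th difference of a polynomial of degree \<open>r < m\<close>. The sum for
  \<open>m + 1\<close> is the first difference of the sum \<open>F\<close> for \<open>m\<close>, and \<open>F\<close> is constant because its derivative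
  is, up to a factor, the sum with \<open>r - 1 < m\<close> in place of \<open>r\<close>. Hence induction on \<open>m\<close>.\<close>

lemma alternating_binomial_sum_power_eq_0:
  fixes x :: real
  assumes "r < m"
  shows "(\<Sum>j\<le>m. real (m choose j) * ((-1) ^ j * (x + real j) ^ r)) = 0"
  using assms
proof (induction m arbitrary: r x)
  case (Suc m)
  define F where "F y = (\<Sum>j\<le>m. real (m choose j) * ((-1) ^ j * (y + real j) ^ r))" for y
  have "(F has_field_derivative
          real r * (\<Sum>j\<le>m. real (m choose j) * ((-1) ^ j * (y + real j) ^ (r - 1)))) (at y)" for y
    unfolding F_def sum_distrib_left
    by (rule DERIV_sum) (auto intro!: derivative_eq_intros)
  moreover have "real r * (\<Sum>j\<le>m. real (m choose j) * ((-1) ^ j * (y + real j) ^ (r - 1))) = 0" for y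
    using Suc.IH[of "r - 1" y] Suc.prems by (cases r) auto
  ultimately have "\<forall>y. DERIV F y :> 0"
    by metis
  then have const: "F x = F (x + 1)"
    by (rule DERIV_isconst_all)
  have "(\<Sum>j\<le>Suc m. real (Suc m choose j) * ((-1) ^ j * (x + real j) ^ r)) = F x - F (x + 1)"
    unfolding sum_binomial_Suc F_def
    by (simp add: algebra_simps sum.distrib sum_subtractf)
  then show ?case
    using const by simp
qed simp

text \<open>The case \<open>x = 1\<close> of Abel's generalisation
  \<open>(\<Sum>j\<le>m. (m choose j) * x * (x + j) ^ (j - 1) * (y - j) ^ (m - j)) = (x + y) ^ m\<close> of the binomial
  theorem. Both sides are polynomials in \<open>y\<close> whose derivatives agree by the induction hypothesis.
  At \<open>y = -1\<close> the bases \<open>j + 1\<close> and \<open>y - j\<close> agree up to sign, so the left-hand side becomes an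
  alternating sum of powers of degree \<open>m - 1\<close> and vanishes, as the right-hand side does.\<close>

lemma abel_identity:
  fixes y :: real
  shows "(\<Sum>j\<le>m. real (m choose j) * real (Suc j) ^ (j - 1) * (y - real j) ^ (m - j)) = (y + 1) ^ m"
proof (induction m arbitrary: y)
  case (Suc m)
  define G where "G y = (\<Sum>j\<le>Suc m. real (Suc m choose j) * real (Suc j) ^ (j - 1) * (y - real j) ^ (Suc m - j))
      - (y + 1) ^ Suc m" for y :: real
  have "DERIV G z :> 0" for z
  proof -
    have "DERIV (\<lambda>y. (y + 1) ^ Suc m) z :> real (Suc m) * (z + 1) ^ m"
      using DERIV_pow[of "Suc m" "z + 1"] by (intro DERIV_shift[THEN iffD1]) simp
    then have "DERIV G z :> (\<Sum>j\<le>Suc m. real (Suc m choose j) * real (Suc j) ^ (j - 1)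
             * (real (Suc m - j) * (z - real j) ^ (Suc m - j - 1))) - real (Suc m) * (z + 1) ^ m"
      unfolding G_def
      by (intro DERIV_diff DERIV_sum) (auto intro!: derivative_eq_intros simp del: of_nat_Suc)
    also have "(\<Sum>j\<le>Suc m. real (Suc m choose j) * real (Suc j) ^ (j - 1)
             * (real (Suc m - j) * (z - real j) ^ (Suc m - j - 1)))
        = (\<Sum>j\<le>m. real (Suc m) * (real (m choose j) * real (Suc j) ^ (j - 1) * (z - real j) ^ (m - j)))"
    proof -
      have "real (Suc m choose j) * real (Suc m - j) = real (Suc m) * real (m choose j)" for j
        using binomial_absorb_comp[of "Suc m" j]
        by (metis diff_Suc_1 mult.commute of_nat_mult)
      moreover have "c * p * (d * e) = s * (b * p * e)" if "c * d = s * b" for b c d e p s :: real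
      proof -
        have "c * p * (d * e) = (c * d) * (p * e)" by (simp add: mult_ac)
        then show ?thesis using that by (simp add: mult_ac)
      qed
      ultimately have "real (Suc m choose j) * real (Suc j) ^ (j - 1)
             * (real (Suc m - j) * (z - real j) ^ (m - j))
          = real (Suc m) * (real (m choose j) * real (Suc j) ^ (j - 1) * (z - real j) ^ (m - j))" for j
        by blast
      moreover have "Suc m - j - 1 = m - j" for j
        by simp
      ultimately show ?thesis
        by (simp only: sum.atMost_Suc) simp
    qed
    also have "\<dots> = real (Suc m) * (z + 1) ^ m"
      using Suc.IH by (simp only: sum_distrib_left[symmetric])
    finally show ?thesis by simp
  qed
  then have "G y = G (- 1)"
    by (intro DERIV_isconst_all) auto
  also have "G (- 1) = 0"
  proof -
    have "real (Suc m choose j) * real (Suc j) ^ (j - 1) * (- 1 - real j) ^ (Suc m - j)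
        = (-1) ^ Suc m * (real (Suc m choose j) * ((-1) ^ j * (1 + real j) ^ m))" if "j \<le> Suc m" for j
    proof -
      have "(- 1 - real j) ^ (Suc m - j) = (-1) ^ (Suc m - j) * (1 + real j) ^ (Suc m - j)"
        by (subst power_mult_distrib[symmetric]) simp
      moreover have "(-1 :: real) ^ (Suc m - j) = (-1) ^ Suc m * (-1) ^ j"
        using that by (simp add: minus_one_power_iff split: if_splits)
      moreover have "real (Suc j) ^ (j - 1) * (1 + real j) ^ (Suc m - j) = (1 + real j) ^ m"
        if "j \<noteq> 0"
      proof -
        have "j - 1 + (Suc m - j) = m" using that \<open>j \<le> Suc m\<close> by simp
        then show ?thesis by (metis of_nat_Suc power_add)
      qed
      ultimately show ?thesis
        by (cases "j = 0") (auto simp del: binomial_Suc_Suc of_nat_Suc)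
    qed
    then have "(\<Sum>j\<le>Suc m. real (Suc m choose j) * real (Suc j) ^ (j - 1) * (- 1 - real j) ^ (Suc m - j))
        = (-1) ^ Suc m * (\<Sum>j\<le>Suc m. real (Suc m choose j) * ((-1) ^ j * (1 + real j) ^ m))"
      unfolding sum_distrib_left by (intro sum.cong) auto
    also have "\<dots> = 0"
      using alternating_binomial_sum_power_eq_0[of m "Suc m" 1] by simp
    finally show ?thesis
      by (simp add: G_def)
  qed
  finally show ?case
    by (simp add: G_def)
qed simp

section \<open>Counting covering assignments by their first gap\<close>

text \<open>Full car parks described without the parking process: for every \<open>j\<close>, at least \<open>j\<close> drivers want one
  of the first \<open>j\<close> spaces. The set \<open>I\<close> of drivers is arbitrary so that the count can be applied to the
  drivers to the left of a gap, who need not be an initial segment of all drivers.\<close>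

definition covering :: "'a set \<Rightarrow> nat \<Rightarrow> ('a \<Rightarrow> nat) set" where
  "covering I n = {f \<in> I \<rightarrow>\<^sub>E {1..n}. \<forall>j\<in>{1..n}. j \<le> card {i \<in> I. f i \<le> j}}"

text \<open>The assignments for which \<open>Suc s\<close> is the first \<open>j\<close> violating the condition of \<^const>\<open>covering\<close>. In the
  parking process \<open>Suc s\<close> is then the first space that stays empty.\<close>

definition first_gap :: "'a set \<Rightarrow> nat \<Rightarrow> nat \<Rightarrow> ('a \<Rightarrow> nat) set" where
  "first_gap I n s = {f \<in> I \<rightarrow>\<^sub>E {1..n}.
     card {i \<in> I. f i \<le> Suc s} \<le> s \<and> (\<forall>j\<in>{1..s}. j \<le> card {i \<in> I. f i \<le> j})}"

text \<open>The drivers in \<open>A\<close> fill the \<open>s\<close> spaces to the left of the gap, no driver wants the space \<open>Suc s\<close>, and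
  the other drivers choose freely among the spaces to its right.\<close>

definition split_at_gap :: "'a set \<Rightarrow> nat \<Rightarrow> nat \<Rightarrow> 'a set \<Rightarrow> (('a \<Rightarrow> nat) \<times> ('a \<Rightarrow> nat)) set" where
  "split_at_gap I n s A = covering A s \<times> ((I - A) \<rightarrow>\<^sub>E {Suc (Suc s)..n})"

definition join_on :: "'a set \<Rightarrow> ('a \<Rightarrow> 'b) \<times> ('a \<Rightarrow> 'b) \<Rightarrow> 'a \<Rightarrow> 'b" where
  "join_on A = (\<lambda>(g, h) i. if i \<in> A then g i else h i)"

lemma finite_covering: "finite I \<Longrightarrow> finite (covering I n)"
  unfolding covering_def by (rule finite_subset[of _ "I \<rightarrow>\<^sub>E {1..n}"]) (auto intro: finite_PiE)

lemma finite_first_gap: "finite I \<Longrightarrow> finite (first_gap I n s)"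
  unfolding first_gap_def by (rule finite_subset[of _ "I \<rightarrow>\<^sub>E {1..n}"]) (auto intro: finite_PiE)

lemma covering_empty_if_few:
  assumes "finite I" "card I < n"
  shows "covering I n = {}"
proof -
  have "\<not> n \<le> card {i \<in> I. f i \<le> n}" for f
    using card_mono[of I "{i \<in> I. f i \<le> n}"] assms by auto
  moreover have "n \<in> {1..n}" using assms by auto
  ultimately show ?thesis unfolding covering_def by blast
qed

lemma funcset_eq_covering_Un_first_gap:
  "I \<rightarrow>\<^sub>E {1..n} = covering I n \<union> (\<Union>s<n. first_gap I n s)" (is "?P = ?R")
proof (intro equalityI subsetI)
  fix f assume f: "f \<in> ?P"
  show "f \<in> ?R"
  proof (cases "f \<in> covering I n")
    case False
    define Q where "Q s \<longleftrightarrow> s < n \<and> card {i \<in> I. f i \<le> Suc s} \<le> s" for s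
    obtain j where j: "j \<in> {1..n}" "\<not> j \<le> card {i \<in> I. f i \<le> j}"
      using False f by (auto simp: covering_def)
    then have "Q (j - 1)" by (auto simp: Q_def)
    then have least: "Q (Least Q)" by (rule LeastI)
    have "j \<le> card {i \<in> I. f i \<le> j}" if "j \<in> {1..Least Q}" for j
    proof -
      have "\<not> Q (j - 1)"
        using that by (intro not_less_Least) auto
      then show ?thesis
        using that least by (auto simp: Q_def)
    qed
    then have "f \<in> first_gap I n (Least Q)"
      using f least by (auto simp: first_gap_def Q_def)
    then show ?thesis using least by (auto simp: Q_def)
  qed auto
qed (auto simp: covering_def first_gap_def)

lemma card_first_gap_Un:
  assumes "finite I"
  shows "card (I \<rightarrow>\<^sub>E {1..n}) = card (covering I n) + (\<Sum>s<n. card (first_gap I n s))"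
proof -
  have disj: "first_gap I n s \<inter> first_gap I n t = {}" if "s < t" for s t
  proof -
    have "Suc s \<in> {1..t}" using that by auto
    then have "Suc s \<le> card {i \<in> I. f i \<le> Suc s}" if "f \<in> first_gap I n t" for f
      using that by (simp add: first_gap_def)
    moreover have "card {i \<in> I. f i \<le> Suc s} \<le> s" if "f \<in> first_gap I n s" for f
      using that by (simp add: first_gap_def)
    ultimately show ?thesis by (meson disjoint_iff not_less_eq_eq)
  qed
  have "Suc s \<le> card {i \<in> I. f i \<le> Suc s}" if "f \<in> covering I n" "s < n" for f s
    using that by (simp add: covering_def)
  then have "covering I n \<inter> (\<Union>s<n. first_gap I n s) = {}"
    by (auto simp: first_gap_def simp flip: not_less_eq_eq)
  then have "card (I \<rightarrow>\<^sub>E {1..n}) = card (covering I n) + card (\<Union>s<n. first_gap I n s)"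
    using assms unfolding funcset_eq_covering_Un_first_gap
    by (intro card_Un_disjoint) (auto intro: finite_covering finite_first_gap)
  also have "card (\<Union>s<n. first_gap I n s) = (\<Sum>s<n. card (first_gap I n s))"
  proof (rule card_UN_disjoint)
    show "\<forall>s\<in>{..<n}. \<forall>t\<in>{..<n}. s \<noteq> t \<longrightarrow> first_gap I n s \<inter> first_gap I n t = {}"
      using disj by (metis Int_commute linorder_neqE_nat)
  qed (auto intro: finite_first_gap assms)
  finally show ?thesis .
qed

text \<open>Spaces up to the gap are chosen by drivers in \<open>A\<close> only. Therefore the left part alone decides
  where the first gap is, and \<open>A\<close> can be recovered from the joined assignment.\<close>

lemma below_join_on:
  assumes "A \<subseteq> I" "(g, h) \<in> split_at_gap I n s A" "j \<le> Suc s"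
  shows "{i \<in> I. join_on A (g, h) i \<le> j} = {i \<in> A. g i \<le> j}"
  using assms by (force simp: join_on_def split_at_gap_def PiE_iff)

lemma below_join_on_eq:
  assumes "A \<subseteq> I" "(g, h) \<in> split_at_gap I n s A" "s \<le> j" "j \<le> Suc s"
  shows "{i \<in> I. join_on A (g, h) i \<le> j} = A"
proof -
  have "g i \<le> s" if "i \<in> A" for i
    using assms that by (auto simp: split_at_gap_def covering_def PiE_iff)
  then show ?thesis
    using below_join_on[OF assms(1,2,4)] assms(3) by fastforce
qed

text \<open>For an assignment with first gap \<open>Suc s\<close>, let \<open>A\<close> be the drivers who want one of the first \<open>s\<close> spaces.
  There are at least \<open>s\<close> of them, since \<open>s\<close> is not a gap, and at most \<open>s\<close> drivers want one of the
  first \<open>Suc s\<close> spaces. So both numbers are \<open>s\<close>, and nobody wants \<open>Suc s\<close>.\<close>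

lemma first_gap_eq_Union:
  assumes "finite I" "s < n"
  shows "first_gap I n s = (\<Union>A\<in>{A. A \<subseteq> I \<and> card A = s}. join_on A ` split_at_gap I n s A)"
proof (intro equalityI subsetI)
  fix f assume f: "f \<in> first_gap I n s"
  define A where "A = {i \<in> I. f i \<le> s}"
  have sub: "A \<subseteq> {i \<in> I. f i \<le> Suc s}" by (auto simp: A_def)
  have "card A \<le> card {i \<in> I. f i \<le> Suc s}"
    using assms by (intro card_mono sub) auto
  moreover have "s \<le> card A"
    using f by (cases "s = 0") (auto simp: first_gap_def A_def)
  moreover have "card {i \<in> I. f i \<le> Suc s} \<le> s"
    using f by (auto simp: first_gap_def)
  ultimately have cardA: "card A = s" and "card A = card {i \<in> I. f i \<le> Suc s}"
    by auto
  then have eq: "A = {i \<in> I. f i \<le> Suc s}"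
    using assms sub by (intro card_subset_eq) auto
  have "restrict f A \<in> covering A s"
  proof -
    have "{i \<in> A. restrict f A i \<le> j} = {i \<in> I. f i \<le> j}" if "j \<le> s" for j
      using that by (auto simp: A_def)
    then show ?thesis
      using f by (auto simp: covering_def first_gap_def A_def PiE_iff)
  qed
  moreover have "restrict f (I - A) \<in> (I - A) \<rightarrow>\<^sub>E {Suc (Suc s)..n}"
  proof -
    have "Suc (Suc s) \<le> f i" if "i \<in> I - A" for i
      using that eq by (metis (mono_tags, lifting) DiffE mem_Collect_eq not_less_eq_eq)
    then show ?thesis using f by (auto simp: first_gap_def PiE_iff)
  qed
  ultimately have "(restrict f A, restrict f (I - A)) \<in> split_at_gap I n s A"
    by (simp add: split_at_gap_def)
  moreover have "f = join_on A (restrict f A, restrict f (I - A))"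
    using f by (auto simp: join_on_def first_gap_def PiE_iff extensional_def)
  ultimately show "f \<in> (\<Union>A\<in>{A. A \<subseteq> I \<and> card A = s}. join_on A ` split_at_gap I n s A)"
    using cardA by (intro UN_I[of A]) (auto simp: A_def)
next
  fix f assume "f \<in> (\<Union>A\<in>{A. A \<subseteq> I \<and> card A = s}. join_on A ` split_at_gap I n s A)"
  then obtain A g h where A: "A \<subseteq> I" "card A = s" and gh: "(g, h) \<in> split_at_gap I n s A"
    and f: "f = join_on A (g, h)" by auto
  have "f \<in> I \<rightarrow>\<^sub>E {1..n}"
  proof (rule PiE_I)
    fix i assume "i \<in> I"
    have "g i \<in> {1..s}" if "i \<in> A"
      using gh that by (auto simp: split_at_gap_def covering_def)
    moreover have "h i \<in> {Suc (Suc s)..n}" if "i \<notin> A"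
      using gh that \<open>i \<in> I\<close> by (auto simp: split_at_gap_def)
    ultimately show "f i \<in> {1..n}"
      using \<open>s < n\<close> by (auto simp: f join_on_def)
  next
    fix i assume "i \<notin> I"
    then show "f i = undefined"
      using A(1) gh by (auto simp: f join_on_def split_at_gap_def PiE_iff extensional_def)
  qed
  moreover have "card {i \<in> I. f i \<le> Suc s} \<le> s"
    using below_join_on_eq[OF A(1) gh, of "Suc s"] A(2) by (simp add: f)
  moreover have "j \<le> card {i \<in> I. f i \<le> j}" if "j \<in> {1..s}" for j
    using below_join_on[OF A(1) gh, of j] gh that by (auto simp: f split_at_gap_def covering_def)
  ultimately show "f \<in> first_gap I n s"
    by (simp add: first_gap_def)
qed

lemma inj_on_join_on:
  "inj_on (join_on A) (split_at_gap I n s A)"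
proof (rule inj_onI, clarify)
  fix g h g' h'
  assume gh: "(g, h) \<in> split_at_gap I n s A" "(g', h') \<in> split_at_gap I n s A"
    and eq: "join_on A (g, h) = join_on A (g', h')"
  have "g i = g' i" for i
    using fun_cong[OF eq, of i] gh
    by (cases "i \<in> A") (auto simp: join_on_def split_at_gap_def covering_def PiE_iff extensional_def)
  moreover have "h i = h' i" for i
    using fun_cong[OF eq, of i] gh
    by (cases "i \<in> A") (auto simp: join_on_def split_at_gap_def covering_def PiE_iff extensional_def)
  ultimately show "g = g' \<and> h = h'" by auto
qed

text \<open>The number \<open>c\<close> is a parameter because it is still unknown when this lemma is used in the induction
  that determines it.\<close>

lemma card_first_gap:
  assumes "finite I" "s < n"
    and count: "\<And>A. A \<subseteq> I \<Longrightarrow> card A = s \<Longrightarrow> card (covering A s) = c"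
  shows "card (first_gap I n s) = (card I choose s) * (c * (n - Suc s) ^ (card I - s))"
proof -
  let ?\<A> = "{A. A \<subseteq> I \<and> card A = s}"
  have finA: "finite A" if "A \<in> ?\<A>" for A
    using that finite_subset[OF _ assms(1)] by simp
  have "card (first_gap I n s) = (\<Sum>A\<in>?\<A>. card (join_on A ` split_at_gap I n s A))"
    unfolding first_gap_eq_Union[OF assms(1,2)]
  proof (rule card_UN_disjoint)
    show "\<forall>A\<in>?\<A>. finite (join_on A ` split_at_gap I n s A)"
    proof
      fix A assume "A \<in> ?\<A>"
      then have "finite (covering A s)" "finite ((I - A) \<rightarrow>\<^sub>E {Suc (Suc s)..n})"
        using assms(1) finA[of A] by (simp_all add: finite_covering finite_PiE)
      then show "finite (join_on A ` split_at_gap I n s A)"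
        by (simp add: split_at_gap_def)
    qed
    show "\<forall>A\<in>?\<A>. \<forall>B\<in>?\<A>. A \<noteq> B \<longrightarrow>
            join_on A ` split_at_gap I n s A \<inter> join_on B ` split_at_gap I n s B = {}"
    proof (intro ballI impI, rule ccontr)
      fix A B assume AB: "A \<in> ?\<A>" "B \<in> ?\<A>" "A \<noteq> B"
        and "join_on A ` split_at_gap I n s A \<inter> join_on B ` split_at_gap I n s B \<noteq> {}"
      then obtain g h g' h' where "(g, h) \<in> split_at_gap I n s A" "(g', h') \<in> split_at_gap I n s B"
        "join_on A (g, h) = join_on B (g', h')" by (auto simp: disjoint_iff)
      then have "A = B"
        using below_join_on_eq[of A I g h n s s] below_join_on_eq[of B I g' h' n s s] AB by auto
      then show False using AB by simp
    qed
  qed (use assms(1) in simp)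
  also have "\<dots> = (\<Sum>A\<in>?\<A>. c * (n - Suc s) ^ (card I - s))"
  proof (rule sum.cong[OF refl])
    fix A assume A: "A \<in> ?\<A>"
    have "card (join_on A ` split_at_gap I n s A) = card (split_at_gap I n s A)"
      by (intro card_image inj_on_join_on)
    also have "\<dots> = c * (n - Suc s) ^ (card I - s)"
      using A assms(1) finA[OF A] unfolding split_at_gap_def card_cartesian_product
      by (simp add: count card_PiE card_Diff_subset)
    finally show "card (join_on A ` split_at_gap I n s A) = c * (n - Suc s) ^ (card I - s)" .
  qed
  also have "\<dots> = (card I choose s) * (c * (n - Suc s) ^ (card I - s))"
    using n_subsets[OF assms(1), of s] by simp
  finally show ?thesis .
qed

text \<open>The number of parking functions (Konheim and Weiss). With one space more than drivers every
  assignment has a gap, so summing over the first gap gives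
  \<open>(m + 1) ^ m = (\<Sum>s\<le>m. (m choose s) * c s * (m - s) ^ (m - s))\<close> for the numbers \<open>c s\<close> of parking
  functions. The term \<open>s = m\<close> is \<open>c m\<close>, as \<open>0 ^ 0 = 1\<close>, so these equations determine \<open>c\<close>
  recursively, and by Abel's identity \<open>c s = (s + 1) ^ (s - 1)\<close> solves them.\<close>

lemma card_covering_card:
  assumes "finite I"
  shows "card (covering I (card I)) = Suc (card I) ^ (card I - 1)"
  using assms
proof (induction "card I" arbitrary: I rule: less_induct)
  case less
  let ?m = "card I"
  have "Suc ?m ^ ?m = card (I \<rightarrow>\<^sub>E {1..Suc ?m})"
    using less.prems by (simp add: card_PiE)
  also have "\<dots> = (\<Sum>s<Suc ?m. card (first_gap I (Suc ?m) s))"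
    using card_first_gap_Un[OF less.prems, of "Suc ?m"] less.prems
    by (simp add: covering_empty_if_few del: sum.lessThan_Suc)
  also have "\<dots> = (\<Sum>s<?m. card (first_gap I (Suc ?m) s)) + card (covering I ?m)"
  proof -
    have "card (first_gap I (Suc ?m) ?m) = (card I choose ?m) * (card (covering I ?m) * (Suc ?m - Suc ?m) ^ (card I - ?m))"
      by (rule card_first_gap) (use less.prems card_subset_eq in auto)
    then show ?thesis by simp
  qed
  also have "(\<Sum>s<?m. card (first_gap I (Suc ?m) s))
      = (\<Sum>s<?m. (?m choose s) * (Suc s ^ (s - 1) * (?m - s) ^ (?m - s)))"
  proof (rule sum.cong[OF refl])
    fix s assume s: "s \<in> {..<?m}"
    have "card (first_gap I (Suc ?m) s)
        = (?m choose s) * (Suc s ^ (s - 1) * (Suc ?m - Suc s) ^ (?m - s))"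
    proof (rule card_first_gap)
      fix A assume "A \<subseteq> I" "card A = s"
      then show "card (covering A s) = Suc s ^ (s - 1)"
        using less.hyps[of A] s finite_subset[OF _ less.prems] by auto
    qed (use less.prems s in auto)
    then show "card (first_gap I (Suc ?m) s)
        = (?m choose s) * (Suc s ^ (s - 1) * (?m - s) ^ (?m - s))" by simp
  qed
  finally have "real (Suc ?m ^ ?m)
      = (\<Sum>s<?m. real (?m choose s) * real (Suc s) ^ (s - 1) * real (?m - s) ^ (?m - s))
        + real (card (covering I ?m))"
    by (simp add: mult.assoc del: of_nat_Suc power_Suc)
  moreover have "real (Suc ?m ^ ?m)
      = (\<Sum>s<?m. real (?m choose s) * real (Suc s) ^ (s - 1) * real (?m - s) ^ (?m - s))
        + real (Suc ?m) ^ (?m - 1)"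
    using abel_identity[of ?m "real ?m"]
    by (simp add: lessThan_Suc_atMost[symmetric] of_nat_diff add.commute)
  ultimately have "real (card (covering I ?m)) = real (Suc ?m ^ (?m - 1))"
    by (simp del: of_nat_Suc)
  then show ?case
    by (simp only: of_nat_eq_iff)
qed

lemma power_eq_card_covering_plus_gaps:
  assumes "finite I"
  shows "n ^ card I = card (covering I n)
     + (\<Sum>s<n. (card I choose s) * (Suc s ^ (s - 1) * (n - Suc s) ^ (card I - s)))"
proof -
  have "n ^ card I = card (I \<rightarrow>\<^sub>E {1..n})"
    using assms by (simp add: card_PiE)
  also have "\<dots> = card (covering I n) + (\<Sum>s<n. card (first_gap I n s))"
    by (rule card_first_gap_Un[OF assms])
  also have "(\<Sum>s<n. card (first_gap I n s))
     = (\<Sum>s<n. (card I choose s) * (Suc s ^ (s - 1) * (n - Suc s) ^ (card I - s)))"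
  proof (intro sum.cong[OF refl] card_first_gap)
    fix s A assume "A \<subseteq> I" "card A = s"
    then show "card (covering A s) = Suc s ^ (s - 1)"
      using card_covering_card[of A] finite_subset[of A I] assms by auto
  qed (use assms in auto)
  finally show ?thesis .
qed

section \<open>The parking process\<close>

lemma parking_space_Some:
  assumes "parking_space n S p = Some q" "p \<in> {1..n}"
  shows "q \<in> {p..n}" "q \<notin> S" "\<And>r. r \<in> {p..n} \<Longrightarrow> r \<notin> S \<Longrightarrow> q \<le> r"
proof -
  have "q \<in> {p..n} - S"
  proof (cases "p \<in> S")
    case True
    then have ne: "{p<..n} - S \<noteq> {}" and q: "q = Min ({p<..n} - S)"
      using assms by (simp_all add: parking_space_def split: if_splits)
    have "q \<in> {p<..n} - S"
      unfolding q by (rule Min_in[OF _ ne]) simp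
    then show ?thesis by auto
  qed (use assms in \<open>simp add: parking_space_def\<close>)
  then show "q \<in> {p..n}" "q \<notin> S" by simp_all
  show "q \<le> r" if "r \<in> {p..n}" "r \<notin> S" for r
    using assms that by (cases "r = p") (auto simp: parking_space_def split: if_splits)
qed

lemma parking_space_None:
  assumes "parking_space n S p = None"
  shows "{p..n} \<subseteq> S"
proof
  fix r assume "r \<in> {p..n}"
  then show "r \<in> S"
    using assms by (cases "r = p") (auto simp: parking_space_def split: if_splits)
qed

lemma occupied_subset:
  assumes "\<forall>i\<in>{1..k}. f i \<in> {1..n}"
  shows "occupied n f k \<subseteq> {1..n}"
  using assms
proof (induction k)
  case (Suc k)
  have "q \<in> {1..n}" if "parking_space n (occupied n f k) (f (Suc k)) = Some q" for q
  proof -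
    have "f (Suc k) \<in> {1..n}" using Suc.prems by simp
    then show ?thesis using parking_space_Some(1)[OF that] by simp
  qed
  then show ?case
    using Suc by (cases "parking_space n (occupied n f k) (f (Suc k))") auto
qed simp

lemma below_Suc:
  "{i \<in> {1..Suc k}. f i \<le> s} = (if f (Suc k) \<le> s then insert (Suc k) {i \<in> {1..k}. f i \<le> s} else {i \<in> {1..k}. f i \<le> s})"
  by (auto simp: le_Suc_eq)

lemma card_below_Suc:
  "card {i \<in> {1..Suc k}. f i \<le> s} = card {i \<in> {1..k}. f i \<le> s} + (if f (Suc k) \<le> s then 1 else 0)"
  unfolding below_Suc by simp

text \<open>Cars only move to the right, so a car in one of the first \<open>j\<close> spaces wanted one of them.\<close>

lemma card_occupied_le:
  assumes "\<forall>i\<in>{1..k}. f i \<in> {1..n}"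
  shows "card (occupied n f k \<inter> {1..j}) \<le> card {i \<in> {1..k}. f i \<le> j}"
  using assms
proof (induction k)
  case (Suc k)
  have IH: "card (occupied n f k \<inter> {1..j}) \<le> card {i \<in> {1..k}. f i \<le> j}"
    using Suc by simp
  show ?case
  proof (cases "parking_space n (occupied n f k) (f (Suc k))")
    case None
    then show ?thesis unfolding card_below_Suc using IH by simp
  next
    case (Some q)
    then have "f (Suc k) \<le> q"
      using parking_space_Some(1)[OF Some] Suc.prems by simp
    moreover have "occupied n f (Suc k) \<inter> {1..j} \<subseteq> (if q \<le> j then insert q (occupied n f k \<inter> {1..j}) else occupied n f k \<inter> {1..j})"
      using Some by auto
    then have "card (occupied n f (Suc k) \<inter> {1..j}) \<le> card (if q \<le> j then insert q (occupied n f k \<inter> {1..j}) else occupied n f k \<inter> {1..j})"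
      by (rule card_mono[rotated]) simp
    moreover have "\<dots> \<le> card (occupied n f k \<inter> {1..j}) + (if q \<le> j then 1 else 0)"
      by (simp add: card_insert_if)
    ultimately show ?thesis unfolding card_below_Suc using IH by (auto split: if_splits)
  qed
qed simp

text \<open>No car ever passes a space that stays free, so all drivers who want a space up to \<open>s\<close> park there.\<close>

lemma card_below_le_occupied:
  assumes "\<forall>i\<in>{1..k}. f i \<in> {1..n}" "s \<in> {1..n}" "s \<notin> occupied n f k"
  shows "card {i \<in> {1..k}. f i \<le> s} \<le> card (occupied n f k \<inter> {1..s})"
  using assms
proof (induction k)
  case (Suc k)
  let ?O = "occupied n f k"
  have IH: "card {i \<in> {1..k}. f i \<le> s} \<le> card (?O \<inter> {1..s})"
    using Suc by simp
  have s: "s \<notin> ?O" using Suc.prems by simp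
  have p: "f (Suc k) \<in> {1..n}" using Suc.prems by simp
  show ?case
  proof (cases "f (Suc k) \<le> s")
    case True
    then have "\<not> {f (Suc k)..n} \<subseteq> ?O" using s Suc.prems(2) by auto
    then obtain q where q: "parking_space n ?O (f (Suc k)) = Some q"
      using parking_space_None by blast
    have "q \<notin> ?O" "q \<le> s" "1 \<le> q"
      using parking_space_Some[OF q p] True s Suc.prems(2) p by auto
    then have "occupied n f (Suc k) \<inter> {1..s} = insert q (?O \<inter> {1..s})" "q \<notin> ?O \<inter> {1..s}"
      using q by auto
    then have "card (occupied n f (Suc k) \<inter> {1..s}) = Suc (card (?O \<inter> {1..s}))"
      by simp
    then show ?thesis unfolding card_below_Suc using IH by simp
  next
    case False
    have "card (?O \<inter> {1..s}) \<le> card (occupied n f (Suc k) \<inter> {1..s})"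
      by (rule card_mono) auto
    then show ?thesis unfolding card_below_Suc using False IH by simp
  qed
qed simp

lemma occupied_full_iff_covering:
  assumes "f \<in> assignments n m"
  shows "occupied n f m = {1..n} \<longleftrightarrow> f \<in> covering {1..m} n"
proof -
  have f: "\<forall>i\<in>{1..m}. f i \<in> {1..n}" and PiE: "f \<in> {1..m} \<rightarrow>\<^sub>E {1..n}"
    using assms by (auto simp: assignments_def)
  show ?thesis
  proof
    assume full: "occupied n f m = {1..n}"
    have "j \<le> card {i \<in> {1..m}. f i \<le> j}" if "j \<in> {1..n}" for j
    proof -
      have "{1..n} \<inter> {1..j} = {1..j}" using that by auto
      then have "card (occupied n f m \<inter> {1..j}) = j"
        unfolding full by (simp only: card_atLeastAtMost)
      then show ?thesis using card_occupied_le[OF f, of j] by simp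
    qed
    then show "f \<in> covering {1..m} n"
      using PiE by (simp add: covering_def)
  next
    assume cov: "f \<in> covering {1..m} n"
    have "s \<in> occupied n f m" if "s \<in> {1..n}" for s
    proof (rule ccontr)
      assume s: "s \<notin> occupied n f m"
      have "s \<le> card {i \<in> {1..m}. f i \<le> s}"
        using cov that by (simp add: covering_def)
      also have "\<dots> \<le> card (occupied n f m \<inter> {1..s})"
        by (rule card_below_le_occupied[OF f that s])
      also have "\<dots> \<le> card {1..<s}"
        using s by (intro card_mono) (auto simp: le_less)
      finally show False using that by auto
    qed
    then show "occupied n f m = {1..n}"
      using occupied_subset[OF f] by blast
  qed
qed

text \<open>This turns the condition on the number of failing drivers into one on the occupied spaces.\<close>

lemma card_failing_plus_card_occupied:
  assumes "\<forall>i\<in>{1..k}. f i \<in> {1..n}"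
  shows "card (failing n k f) + card (occupied n f k) = k"
  using assms
proof (induction k)
  case 0
  then show ?case by (simp add: failing_def)
next
  case (Suc k)
  let ?O = "occupied n f k"
  have IH: "card (failing n k f) + card ?O = k"
    using Suc by simp
  have fin: "finite ?O"
    using occupied_subset[of k f n] Suc.prems finite_subset by fastforce
  have failing_Suc: "failing n (Suc k) f = failing n k f \<union>
      (if parking_space n ?O (f (Suc k)) = None then {Suc k} else {})"
    by (auto simp: failing_def le_Suc_eq)
  have "finite (failing n k f)" "Suc k \<notin> failing n k f"
    by (auto simp: failing_def)
  then show ?case
    using IH fin parking_space_Some(2)[of n ?O "f (Suc k)"] Suc.prems
    by (cases "parking_space n ?O (f (Suc k))") (auto simp: failing_Suc)
qed

lemma finite_assignments: "finite (assignments n m)"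
  by (simp add: assignments_def finite_PiE)

lemma prob_full_eq_card_covering:
  assumes "n > 0"
  shows "prob_full n m = real (card (covering {1..m} n)) / real n ^ m"
proof -
  have eq: "assignments n m \<inter> {f. occupied n f m = {1..n}} = covering {1..m} n"
    using occupied_full_iff_covering[of _ n m]
    by (auto simp: assignments_def covering_def)
  have card: "card (assignments n m) = n ^ m"
    by (simp add: assignments_def card_PiE)
  then have nonempty: "assignments n m \<noteq> {}"
    using assms by force
  then show ?thesis
    unfolding prob_full_def measure_pmf_of_set[OF nonempty finite_assignments] eq card by simp
qed

lemma cp_eq_card_covering: "cp n m (int m - int n) = card (covering {1..m} n)"
proof -
  have "int (card (failing n m f)) = int m - int n \<longleftrightarrow> f \<in> covering {1..m} n"
    if f: "f \<in> assignments n m" for f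
  proof -
    have range: "\<forall>i\<in>{1..m}. f i \<in> {1..n}"
      using f by (auto simp: assignments_def)
    have "int (card (failing n m f)) = int m - int n \<longleftrightarrow> card (occupied n f m) = card {1..n}"
      using card_failing_plus_card_occupied[OF range] by auto
    also have "\<dots> \<longleftrightarrow> occupied n f m = {1..n}"
      using card_subset_eq[OF _ occupied_subset[OF range]] by auto
    finally show ?thesis
      using occupied_full_iff_covering[OF f] by simp
  qed
  then have "{f \<in> assignments n m. int (card (failing n m f)) = int m - int n} = covering {1..m} n"
    by (auto simp: covering_def assignments_def)
  then show ?thesis
    by (simp add: cp_def)
qed

section \<open>The probability of each first gap\<close>

text \<open>For \<open>j < n\<close>, the probability that \<open>Suc j\<close> is the first space left empty.\<close>

definition gap_prob :: "nat \<Rightarrow> nat \<Rightarrow> nat \<Rightarrow> real" where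
  "gap_prob n m j = real (m choose j) * real (Suc j) ^ (j - 1) * real (n - Suc j) ^ (m - j) / real n ^ m"

lemma prob_full_eq_sum:
  assumes "n > 0"
  shows "prob_full n m = 1 - (\<Sum>j<n. gap_prob n m j)"
proof -
  have "real (n ^ m) = real (card (covering {1..m} n)) + (\<Sum>j<n. gap_prob n m j * real n ^ m)"
    using power_eq_card_covering_plus_gaps[of "{1..m}" n] assms
    by (simp add: gap_prob_def mult.assoc)
  then have "real (card (covering {1..m} n)) = real n ^ m * (1 - (\<Sum>j<n. gap_prob n m j))"
    by (simp add: sum_distrib_left algebra_simps)
  then show ?thesis
    using assms by (simp add: prob_full_eq_card_covering)
qed

lemma prob_full_eq_0:
  assumes "m < n"
  shows "prob_full n m = 0"
  using assms by (simp add: prob_full_eq_card_covering covering_empty_if_few)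

text \<open>The number \<open>(n + 1) ^ (n - 1)\<close> of parking functions among the \<open>n ^ n\<close> assignments is about
  \<open>exp 1 / n\<close> of the total.\<close>

lemma prob_full_diagonal_tendsto_0: "(\<lambda>n. prob_full n n) \<longlonglongrightarrow> 0"
proof -
  have eq: "prob_full n n = (1 + 1 / real n) ^ n * inverse (real (Suc n))" if "n > 0" for n
  proof -
    have "prob_full n n = real (Suc n) ^ (n - 1) / real n ^ n"
      using card_covering_card[of "{1..n}"] that by (simp add: prob_full_eq_card_covering)
    also have "real (Suc n) ^ (n - 1) = real (Suc n) ^ n * inverse (real (Suc n))"
      using that by (cases n) auto
    also have "real (Suc n) ^ n * inverse (real (Suc n)) / real n ^ n
        = (real (Suc n) / real n) ^ n * inverse (real (Suc n))"
      by (simp add: power_divide)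
    also have "real (Suc n) / real n = 1 + 1 / real n"
      using that by (simp add: field_simps)
    finally show ?thesis .
  qed
  have "(\<lambda>n. (1 + 1 / real n) ^ n * inverse (real (Suc n))) \<longlonglongrightarrow> exp 1 * 0"
    by (intro tendsto_mult tendsto_exp_limit_sequentially LIMSEQ_inverse_real_of_nat)
  then have "(\<lambda>n. (1 + 1 / real n) ^ n * inverse (real (Suc n))) \<longlonglongrightarrow> 0" by simp
  moreover have "eventually (\<lambda>n. (1 + 1 / real n) ^ n * inverse (real (Suc n)) = prob_full n n) sequentially"
    using eventually_gt_at_top[of 0] by eventually_elim (simp add: eq)
  ultimately show ?thesis
    by (rule Lim_transform_eventually)
qed

lemma tendsto_binomial_over_power:
  fixes m :: "nat \<Rightarrow> nat"
  assumes "(\<lambda>n. real (m n) / real n) \<longlonglongrightarrow> l"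
  shows "(\<lambda>n. real (m n choose j) / real n ^ j) \<longlonglongrightarrow> l ^ j / fact j"
proof -
  have "real (m n choose j) / real n ^ j = (\<Prod>i<j. real (m n) / real n - real i / real n) / fact j" for n
    by (simp add: binomial_gbinomial gbinomial_prod_rev atLeast0LessThan
        diff_divide_distrib[symmetric] prod_dividef)
  moreover have "(\<lambda>n. (\<Prod>i<j. real (m n) / real n - real i / real n) / fact j)
      \<longlonglongrightarrow> (\<Prod>i<j. l - 0) / fact j"
    by (intro tendsto_intros assms tendsto_divide_0[OF tendsto_const] filterlim_at_top_imp_at_infinity
        filterlim_real_sequentially) auto
  ultimately show ?thesis by simp
qed

text \<open>For \<open>m \<approx> l * n\<close>, three factors have a limit: \<open>(m choose j) / n ^ j\<close>, the constant
  \<open>(j + 1) ^ (j - 1)\<close>, and \<open>(1 - (j + 1) / n) ^ (m - j)\<close>. The last one is rewritten as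
  \<open>((1 - (j + 1) / n) ^ n) powr (m / n - j / n)\<close>, where base and exponent converge.\<close>

lemma gap_prob_tendsto:
  fixes m :: "nat \<Rightarrow> nat"
  assumes lim: "(\<lambda>n. real (m n) / real n) \<longlonglongrightarrow> l" and ge: "eventually (\<lambda>n. n \<le> m n) sequentially"
  shows "(\<lambda>n. gap_prob n (m n) j)
     \<longlonglongrightarrow> l ^ j / fact j * real (Suc j) ^ (j - 1) * exp (- (real (Suc j) * l))"
proof -
  have "(\<lambda>n. (1 + (- real (Suc j)) / real n) ^ n) \<longlonglongrightarrow> exp (- real (Suc j))"
    by (rule tendsto_exp_limit_sequentially)
  moreover have "(\<lambda>n. real (m n) / real n - real j / real n) \<longlonglongrightarrow> l - 0"
    by (intro tendsto_intros lim tendsto_divide_0[OF tendsto_const] filterlim_at_top_imp_at_infinity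
        filterlim_real_sequentially)
  ultimately have "(\<lambda>n. ((1 + (- real (Suc j)) / real n) ^ n) powr (real (m n) / real n - real j / real n))
      \<longlonglongrightarrow> exp (- real (Suc j)) powr (l - 0)"
    by (intro tendsto_powr) auto
  also have "exp (- real (Suc j)) powr (l - 0) = exp (- (real (Suc j) * l))"
    by (simp add: powr_def mult.commute del: of_nat_Suc)
  finally have "(\<lambda>n. real (m n choose j) / real n ^ j * real (Suc j) ^ (j - 1)
        * ((1 + (- real (Suc j)) / real n) ^ n) powr (real (m n) / real n - real j / real n))
     \<longlonglongrightarrow> l ^ j / fact j * real (Suc j) ^ (j - 1) * exp (- (real (Suc j) * l))"
    by (intro tendsto_mult tendsto_const tendsto_binomial_over_power lim)
  moreover have "eventually (\<lambda>n. real (m n choose j) / real n ^ j * real (Suc j) ^ (j - 1)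
        * ((1 + (- real (Suc j)) / real n) ^ n) powr (real (m n) / real n - real j / real n)
      = gap_prob n (m n) j) sequentially"
    using ge eventually_gt_at_top[of "Suc j"]
  proof eventually_elim
    case (elim n)
    let ?b = "1 + (- real (Suc j)) / real n"
    have b: "?b = real (n - Suc j) / real n"
      using elim by (simp add: of_nat_diff field_simps)
    have "?b > 0"
      unfolding b using elim by simp
    then have "(?b ^ n) powr (real (m n) / real n - real j / real n)
        = ?b powr (real n * (real (m n) / real n - real j / real n))"
      by (simp add: powr_realpow[symmetric] powr_powr)
    also have "real n * (real (m n) / real n - real j / real n) = real (m n - j)"
      using elim by (simp add: of_nat_diff field_simps)
    also have "?b powr real (m n - j) = ?b ^ (m n - j)"
      using \<open>?b > 0\<close> by (rule powr_realpow)
    also have "\<dots> = real (n - Suc j) ^ (m n - j) / real n ^ (m n - j)"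
      unfolding b by (rule power_divide)
    finally have "(?b ^ n) powr (real (m n) / real n - real j / real n)
        = real (n - Suc j) ^ (m n - j) / real n ^ (m n - j)" .
    moreover have "real n ^ m n = real n ^ j * real n ^ (m n - j)"
      using elim by (simp add: power_add[symmetric])
    ultimately show ?case
      by (simp add: gap_prob_def)
  qed
  ultimately show ?thesis
    by (rule Lim_transform_eventually)
qed

text \<open>A Chernoff bound. With \<open>p = (j + 1) / n\<close>, the quantity is \<open>1 / (j + 1)\<close> times the probability that a
  binomial variable with parameters \<open>m\<close> and \<open>p\<close> equals \<open>j\<close>. Its mean \<open>m * p\<close> is at least about
  \<open>l * (j + 1)\<close>, well above \<open>j\<close>. Evaluating its generating function \<open>(p * z + 1 - p) ^ m\<close> at
  \<open>z = 1 / l\<close>, nearly the best choice for the mean \<open>l * (j + 1)\<close>, bounds the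
  probability by \<open>l ^ j * exp (- p * (1 - 1 / l) * m)\<close>. The slack \<open>1\<close> in \<open>m \<ge> l * n - 1\<close>, which comes from
  rounding, costs at most the constant factor \<open>exp 1\<close> because \<open>p \<le> 1\<close>.\<close>

lemma gap_prob_le:
  assumes "n > 0" "j < n" "n \<le> m" and l: "l > 1" "l * real n - 1 \<le> real m"
  shows "gap_prob n m j \<le> exp 1 * (l * exp (1 - l)) ^ j"
proof -
  define p where "p = real (Suc j) / real n"
  define q where "q = real (n - Suc j) / real n"
  have pq: "p \<ge> 0" "q \<ge> 0" "q = 1 - p" "p \<le> 1"
    using assms by (auto simp: p_def q_def of_nat_diff field_simps)
  have "gap_prob n m j = real (m choose j) * p ^ j * q ^ (m - j) / real (Suc j)"
  proof -
    have "real n ^ m = real n ^ j * real n ^ (m - j)"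
      using assms by (simp add: power_add[symmetric])
    moreover have "real (Suc j) ^ (j - 1) = real (Suc j) ^ j / real (Suc j)"
      by (cases j) auto
    ultimately show ?thesis
      by (simp add: gap_prob_def p_def q_def power_divide)
  qed
  also have "\<dots> \<le> real (m choose j) * p ^ j * q ^ (m - j) / 1"
    using pq by (intro divide_left_mono) auto
  also have "\<dots> = l ^ j * (real (m choose j) * (p / l) ^ j * q ^ (m - j))"
    using l by (simp add: power_divide)
  \<comment> \<open>a single term of the generating function at \<open>1 / l\<close>\<close>
  also have "real (m choose j) * (p / l) ^ j * q ^ (m - j) \<le> (p / l + q) ^ m"
    unfolding binomial_ring
    by (rule member_le_sum) (use pq l assms in auto)
  also have "(p / l + q) ^ m \<le> exp (- (p * (1 - 1 / l))) ^ m"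
  proof (rule power_mono)
    have "p / l + q = 1 + (- (p * (1 - 1 / l)))"
      by (simp add: pq algebra_simps)
    also have "\<dots> \<le> exp (- (p * (1 - 1 / l)))"
      by (rule exp_ge_add_one_self)
    finally show "p / l + q \<le> exp (- (p * (1 - 1 / l)))" .
  qed (use pq l in auto)
  also have "\<dots> = exp (- (real m * (p * (1 - 1 / l))))"
    by (simp add: exp_of_nat_mult[symmetric])
  also have "\<dots> \<le> exp (1 + real j * (1 - l))"
  proof -
    have nonneg: "0 \<le> p * (1 - 1 / l)" using pq l by simp
    have "(l * real n - 1) * (p * (1 - 1 / l)) \<le> real m * (p * (1 - 1 / l))"
      using l nonneg by (intro mult_right_mono) auto
    moreover have "(l * real n - 1) * (p * (1 - 1 / l)) = real (Suc j) * (l - 1) - p * (1 - 1 / l)"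
    proof -
      have "real n * p = real (Suc j)" using assms by (simp add: p_def)
      moreover have "(l * real n - 1) * (p * (1 - 1 / l)) = (real n * p) * (l * (1 - 1 / l)) - p * (1 - 1 / l)"
        by (simp add: algebra_simps)
      moreover have "l * (1 - 1 / l) = l - 1" using l by (simp add: field_simps)
      ultimately show ?thesis by simp
    qed
    moreover have "p * (1 - 1 / l) \<le> 1"
      using pq l by (intro mult_le_one) auto
    moreover have "real (Suc j) * (l - 1) \<ge> real j * (l - 1)"
      using l by (intro mult_right_mono) auto
    ultimately show ?thesis by (simp add: algebra_simps)
  qed
  finally have "gap_prob n m j \<le> l ^ j * exp (1 + real j * (1 - l))"
    using l by simp
  also have "\<dots> = exp 1 * (l * exp (1 - l)) ^ j"
    by (simp add: exp_add power_mult_distrib exp_of_nat_mult)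
  finally show ?thesis .
qed

lemma gap_prob_nonneg: "gap_prob n m j \<ge> 0"
  by (simp add: gap_prob_def)

lemma mult_exp_one_minus_less_1:
  fixes l :: real
  assumes "l > 1"
  shows "l * exp (1 - l) < 1"
proof -
  have "ln l < l - 1"
    using assms ln_add_one_self_less_self[of "l - 1"] by simp
  then have "exp (ln l + (1 - l)) < exp 0" by (subst exp_less_cancel_iff) simp
  then show ?thesis using assms by (simp add: exp_add)
qed

section \<open>The limit\<close>

text \<open>Dominated convergence for the sum over the first gap. In the limit, the gap \<open>j + 1\<close> contributes
  the term of index \<open>j + 1\<close> of the tree function at \<open>l * exp (- l)\<close>, divided by \<open>l\<close>. The dominating geometric
  series converges because \<open>l * exp (1 - l) < 1\<close>.\<close>

lemma prob_full_tendsto_supercritical: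
  fixes l :: real and m :: "nat \<Rightarrow> nat"
  assumes l: "l > 1" and lim: "(\<lambda>n. real (m n) / real n) \<longlonglongrightarrow> l"
    and ge: "\<And>n. n \<le> m n" and bound: "\<And>n. l * real n - 1 \<le> real (m n)"
  shows "(\<lambda>n. prob_full n (m n)) \<longlonglongrightarrow> 1 - 1 / l * tree_function (l * exp (- l))"
proof -
  define a where "a j n = (if j < n then gap_prob n (m n) j else 0)" for j n
  define b where "b j = l ^ j / fact j * real (Suc j) ^ (j - 1) * exp (- (real (Suc j) * l))" for j
  have tannery: "eventually (\<lambda>n. summable (\<lambda>j. norm (a j n))) sequentially \<and>
      summable (\<lambda>j. norm (b j)) \<and> (\<lambda>n. \<Sum>j. a j n) \<longlonglongrightarrow> suminf b"
  proof (rule tannerys_theorem[where M = "\<lambda>j. exp 1 * (l * exp (1 - l)) ^ j"])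
    show "(\<lambda>n. a j n) \<longlonglongrightarrow> b j" for j
    proof (rule Lim_transform_eventually)
      show "(\<lambda>n. gap_prob n (m n) j) \<longlonglongrightarrow> b j"
        unfolding b_def by (rule gap_prob_tendsto[OF lim]) (simp add: ge)
      show "eventually (\<lambda>n. gap_prob n (m n) j = a j n) sequentially"
        using eventually_gt_at_top[of j] by eventually_elim (simp add: a_def)
    qed
    have "norm (a j n) \<le> exp 1 * (l * exp (1 - l)) ^ j" for j n
      using gap_prob_le[of n j "m n" l] gap_prob_nonneg[of n "m n" j] l ge[of n] bound[of n]
      by (auto simp: a_def)
    then show "eventually (\<lambda>(j, n). norm (a j n) \<le> exp 1 * (l * exp (1 - l)) ^ j) (at_top \<times>\<^sub>F sequentially)"
      by (intro always_eventually) auto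
    show "summable (\<lambda>j. exp 1 * (l * exp (1 - l)) ^ j)"
      using mult_exp_one_minus_less_1[OF l] l by (intro summable_mult summable_geometric) auto
  qed simp
  then have "(\<lambda>n. \<Sum>j. a j n) \<longlonglongrightarrow> suminf b"
    by blast
  moreover have "suminf b = 1 / l * tree_function (l * exp (- l))"
  proof -
    define t where "t j = real (Suc j) ^ j / fact (Suc j) * (l * exp (- l)) ^ Suc j" for j
    have b_eq: "b j = 1 / l * t j" for j
    proof -
      have "real (Suc j) ^ (j - 1) = real (Suc j) ^ j / real (Suc j)"
        by (cases j) auto
      moreover have "exp (- (real (Suc j) * l)) = exp (- l) ^ Suc j"
        by (metis exp_of_nat_mult mult_minus_right)
      ultimately show ?thesis
        using l by (simp add: b_def t_def power_mult_distrib mult_ac del: of_nat_Suc)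
    qed
    have "summable b"
      using tannery by (intro summable_norm_cancel[of b]) blast
    then have "summable (\<lambda>j. l * b j)"
      by (rule summable_mult)
    then have "summable t"
      using l by (simp add: b_eq)
    then have "suminf b = 1 / l * suminf t"
      unfolding b_eq by (rule suminf_mult)
    moreover have "suminf t = tree_function (l * exp (- l))"
      unfolding tree_function_def t_def ..
    ultimately show ?thesis by simp
  qed
  moreover have "(\<Sum>j. a j n) = (\<Sum>j<n. gap_prob n (m n) j)" for n
    by (subst suminf_finite[of "{..<n}"]) (auto simp: a_def)
  ultimately have "(\<lambda>n. 1 - (\<Sum>j<n. gap_prob n (m n) j))
      \<longlonglongrightarrow> 1 - 1 / l * tree_function (l * exp (- l))"
    by (intro tendsto_diff tendsto_const) simp
  moreover have "eventually (\<lambda>n. 1 - (\<Sum>j<n. gap_prob n (m n) j) = prob_full n (m n)) sequentially"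
    using eventually_gt_at_top[of 0] by eventually_elim (simp add: prob_full_eq_sum)
  ultimately show ?thesis
    by (rule Lim_transform_eventually)
qed

theorem theorem10:
  fixes lam :: real
  assumes "lam > 0"
  defines "L \<equiv> (if lam \<le> 1 then 0 else 1 - 1 / lam * tree_function (lam * exp (- lam)))"
  shows "(\<lambda>n. prob_full n (nat \<lfloor>lam * real n\<rfloor>)) \<longlonglongrightarrow> L \<and>
         (\<lambda>n. real (cp n (nat \<lfloor>lam * real n\<rfloor>) (\<lfloor>lam * real n\<rfloor> - int n))
              / real n ^ nat \<lfloor>lam * real n\<rfloor>) \<longlonglongrightarrow> L"
proof -
  define m where "m n = nat \<lfloor>lam * real n\<rfloor>" for n :: nat
  have int_m: "\<lfloor>lam * real n\<rfloor> = int (m n)" for n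
    using assms(1) by (simp add: m_def)
  have upper: "real (m n) \<le> lam * real n" and lower: "lam * real n - 1 \<le> real (m n)" for n
    using int_m[of n] by linarith+
  have prob: "(\<lambda>n. prob_full n (m n)) \<longlonglongrightarrow> L"
  proof -
    consider "lam < 1" | "lam = 1" | "lam > 1" by linarith
    then show ?thesis
    proof cases
      case 1
      have "prob_full n (m n) = 0" if "n > 0" for n
      proof (rule prob_full_eq_0)
        have "lam * real n < real n" using 1 that by simp
        then show "m n < n" using upper[of n] by linarith
      qed
      then have "eventually (\<lambda>n. 0 = prob_full n (m n)) sequentially"
        by (intro eventually_mono[OF eventually_gt_at_top[of 0]]) simp
      then show ?thesis
        using 1 by (auto simp: L_def intro: Lim_transform_eventually[OF tendsto_const])
    next
      case 2
      then show ?thesis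
        using prob_full_diagonal_tendsto_0 by (simp add: L_def m_def)
    next
      case 3
      have "n \<le> m n" for n
      proof -
        have "real n \<le> lam * real n"
          using 3 mult_right_mono[of 1 lam "real n"] by simp
        then have "int n \<le> \<lfloor>lam * real n\<rfloor>"
          by (simp add: le_floor_iff)
        then show ?thesis by (simp add: int_m)
      qed
      moreover have "(\<lambda>n. real (m n) / real n) \<longlonglongrightarrow> lam"
      proof (rule tendsto_sandwich)
        have "lam - 1 / real n \<le> real (m n) / real n" "real (m n) / real n \<le> lam" if "n > 0" for n
          using divide_right_mono[OF lower[of n], of "real n"] upper[of n] that
          by (simp_all add: diff_divide_distrib pos_divide_le_eq)
        then show "eventually (\<lambda>n. lam - 1 / real n \<le> real (m n) / real n) sequentially"
          "eventually (\<lambda>n. real (m n) / real n \<le> lam) sequentially"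
          by (auto intro: eventually_mono[OF eventually_gt_at_top[of 0]])
        have "(\<lambda>n. lam - 1 / real n) \<longlonglongrightarrow> lam - 0"
          by (intro tendsto_intros lim_1_over_n)
        then show "(\<lambda>n. lam - 1 / real n) \<longlonglongrightarrow> lam" by simp
      qed simp
      ultimately show ?thesis
        using 3 prob_full_tendsto_supercritical[of lam m] lower by (simp add: L_def)
    qed
  qed
  moreover have "(\<lambda>n. real (cp n (m n) (int (m n) - int n)) / real n ^ m n) \<longlonglongrightarrow> L"
  proof (rule Lim_transform_eventually[OF prob])
    show "eventually (\<lambda>n. prob_full n (m n) = real (cp n (m n) (int (m n) - int n)) / real n ^ m n) sequentially"
      using eventually_gt_at_top[of 0]
      by eventually_elim (simp add: prob_full_eq_card_covering cp_eq_card_covering)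
  qed
  ultimately show ?thesis
    by (simp add: int_m)
qed

end
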